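(* Let $\mathcal{I}$ be an admissible ideal of $\mathbb{N}$. Let $(X,d)$ and $(Y,\rho)$ be two metric spaces, let $h:X\to Y$ be a uniform homeomorphism, and let $F=\{f_n\}_{n\in\mathbb{N}}$ (maps $f_n:X\to X$) and $G=\{g_n\}_{n\in\mathbb{N}}$ (maps $g_n:Y\to Y$) be uniformly $h$-conjugate. Then $F$ is $\mathcal{I}$-uniformly convergent if and only if $G$ is $\mathcal{I}$-uniformly convergent.
   Context: An ideal of $\mathbb{N}$ (positive integers) is a family $\mathcal{I}\subset 2^{\mathbb{N}}$ such that $A,B\in\mathcal{I}$ implies $A\cup B\in\mathcal{I}$, and $A\in\mathcal{I}$, $B\subset A$ implies $B\in\mathcal{I}$; it is admissible if $\{n\}\in\mathcal{I}$ for every $n\in\mathbb{N}$. A homeomorphism $h:X\to Y$ is a uniform homeomorphism if $h$ is uniformly continuous on $X$ and $h^{-1}$ is uniformly continuous on $Y$. Sequences $F=\{f_n\}$ of maps $X\to X$ and $G=\{g_n\}$ of maps $Y\to Y$ are $h$-conjugate, for a homeomorphism $h:X\to Y$, if $g_k(h(x))=h(f_k(x))$ for every $k\in\mathbb{N}$ and every $x\in X$; they are uniformly $h$-conjugate if moreover $h$ is a uniform homeomorphism. A sequence of maps $f_n:X\to X$ on a metric space $(X,d)$ is $\mathcal{I}$-uniformly convergent to $f:X\to X$ if for every $\varepsilon>0$ there is $A\in\mathcal{I}$ such that $d(f_n(x),f(x))<\varepsilon$ for all $n\in\mathbb{N}\setminus A$ and all $x\in X$; it is $\mathcal{I}$-uniformly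 convergent if it is $\mathcal{I}$-uniformly convergent to some map $f:X\to X$. The same definition is used on $(Y,\rho)$. *)

theory Defs
  imports "HOL-Analysis.Analysis"
begin

text \<open>The index set is the set \<open>{1..}\<close> of positive integers; values of a sequence at
  index \<open>0\<close> are irrelevant. An ideal is allowed to be improper, i.e. to contain \<open>{1..}\<close>.\<close>

definition ideal_of_nats :: "nat set set \<Rightarrow> bool" where
  "ideal_of_nats I \<longleftrightarrow>
     I \<subseteq> Pow {1..} \<and>
     (\<forall>A\<in>I. \<forall>B\<in>I. A \<union> B \<in> I) \<and>
     (\<forall>A\<in>I. \<forall>B. B \<subseteq> A \<longrightarrow> B \<in> I)"

definition admissible_ideal :: "nat set set \<Rightarrow> bool" where
  "admissible_ideal I \<longleftrightarrow> ideal_of_nats I \<and> (\<forall>n\<in>{1..}. {n} \<in> I)"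

definition uniform_homeomorphism :: "'a metric \<Rightarrow> 'b metric \<Rightarrow> ('a \<Rightarrow> 'b) \<Rightarrow> bool" where
  "uniform_homeomorphism X Y h \<longleftrightarrow>
     homeomorphic_map (mtopology_of X) (mtopology_of Y) h \<and>
     uniformly_continuous_map X Y h \<and>
     uniformly_continuous_map Y X (inv_into (mspace X) h)"

definition conjugate ::
    "'a metric \<Rightarrow> 'b metric \<Rightarrow> ('a \<Rightarrow> 'b) \<Rightarrow> (nat \<Rightarrow> 'a \<Rightarrow> 'a) \<Rightarrow> (nat \<Rightarrow> 'b \<Rightarrow> 'b) \<Rightarrow> bool" where
  "conjugate X Y h f g \<longleftrightarrow>
     homeomorphic_map (mtopology_of X) (mtopology_of Y) h \<and>
     (\<forall>k\<in>{1..}. \<forall>x\<in>mspace X. g k (h x) = h (f k x))"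

definition uniformly_conjugate ::
    "'a metric \<Rightarrow> 'b metric \<Rightarrow> ('a \<Rightarrow> 'b) \<Rightarrow> (nat \<Rightarrow> 'a \<Rightarrow> 'a) \<Rightarrow> (nat \<Rightarrow> 'b \<Rightarrow> 'b) \<Rightarrow> bool" where
  "uniformly_conjugate X Y h f g \<longleftrightarrow> conjugate X Y h f g \<and> uniform_homeomorphism X Y h"

definition ideal_uniform_limit ::
    "nat set set \<Rightarrow> 'a metric \<Rightarrow> (nat \<Rightarrow> 'a \<Rightarrow> 'a) \<Rightarrow> ('a \<Rightarrow> 'a) \<Rightarrow> bool" where
  "ideal_uniform_limit I X f l \<longleftrightarrow>
     (\<forall>\<epsilon>>0. \<exists>A\<in>I. \<forall>n\<in>{1..} - A. \<forall>x\<in>mspace X. mdist X (f n x) (l x) < \<epsilon>)"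

definition ideal_uniformly_convergent ::
    "nat set set \<Rightarrow> 'a metric \<Rightarrow> (nat \<Rightarrow> 'a \<Rightarrow> 'a) \<Rightarrow> bool" where
  "ideal_uniformly_convergent I X f \<longleftrightarrow>
     (\<exists>l. l \<in> mspace X \<rightarrow> mspace X \<and> ideal_uniform_limit I X f l)"

end

theory Submission
  imports Defs
begin

text \<open>Since \<open>h\<close> is a bijection, conjugacy says g_n = h o f_n o h^(-1), and
  equally f_n = h^(-1) o g_n o h. If f_n converges to \<open>l\<close>, then g_n converges to h o l
  o h^(-1): uniform continuity of \<open>h\<close> turns \<delta>-closeness of f_n and
  \<open>l\<close> at h^(-1)(y) into \<epsilon>-closeness of the images, for all y at once and
  outside the same set of the ideal. \<open>ideal_uniformly_convergent_transfer\<close> carries out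
  this argument for maps \<open>u\<close> and \<open>v\<close> in the roles of h and h^(-1);
  exchanging these roles gives the converse.\<close>

lemma ideal_uniformly_convergent_transfer:
  fixes X :: "'a metric" and Y :: "'b metric"
  assumes u: "uniformly_continuous_map X Y u"
    and v: "v \<in> mspace Y \<rightarrow> mspace X"
    and f: "\<forall>n\<in>{1..}. f n \<in> mspace X \<rightarrow> mspace X"
    and g: "\<And>n y. n \<in> {1..} \<Longrightarrow> y \<in> mspace Y \<Longrightarrow> g n y = u (f n (v y))"
    and conv: "ideal_uniformly_convergent I X f"
  shows "ideal_uniformly_convergent I Y g"
proof -
  obtain l where l: "l \<in> mspace X \<rightarrow> mspace X" and lim: "ideal_uniform_limit I X f l"
    using conv by (auto simp: ideal_uniformly_convergent_def)
  have "(\<lambda>y. u (l (v y))) \<in> mspace Y \<rightarrow> mspace Y"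
    using u v l by (auto simp: uniformly_continuous_map_def Pi_iff)
  moreover have "ideal_uniform_limit I Y g (\<lambda>y. u (l (v y)))"
    unfolding ideal_uniform_limit_def
  proof (intro allI impI)
    fix \<epsilon> :: real assume "\<epsilon> > 0"
    then obtain \<delta> where "\<delta> > 0" and \<delta>: "\<And>x y. x \<in> mspace X \<Longrightarrow> y \<in> mspace X \<Longrightarrow>
        mdist X y x < \<delta> \<Longrightarrow> mdist Y (u y) (u x) < \<epsilon>"
      using u unfolding uniformly_continuous_map_def by metis
    \<comment> \<open>As \<delta> depends on \<epsilon> alone and not on the point, one exceptional
      set, the one for \<delta>, serves all y.\<close>
    then obtain A where "A \<in> I"
      and A: "\<forall>n\<in>{1..} - A. \<forall>x\<in>mspace X. mdist X (f n x) (l x) < \<delta>"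
      using lim unfolding ideal_uniform_limit_def by blast
    have "mdist Y (g n y) (u (l (v y))) < \<epsilon>" if n: "n \<in> {1..} - A" and y: "y \<in> mspace Y" for n y
    proof -
      have vy: "v y \<in> mspace X" using v y by blast
      then have "f n (v y) \<in> mspace X" "l (v y) \<in> mspace X" using f l n by blast+
      then show ?thesis using \<delta> A n y vy g by simp
    qed
    then show "\<exists>A\<in>I. \<forall>n\<in>{1..} - A. \<forall>y\<in>mspace Y. mdist Y (g n y) (u (l (v y))) < \<epsilon>"
      using \<open>A \<in> I\<close> by blast
  qed
  ultimately show ?thesis
    unfolding ideal_uniformly_convergent_def by blast
qed

theorem theorem4p2:
  fixes I :: "nat set set"
    and X :: "'a metric" and Y :: "'b metric"
    and h :: "'a \<Rightarrow> 'b"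
    and f :: "nat \<Rightarrow> 'a \<Rightarrow> 'a" and g :: "nat \<Rightarrow> 'b \<Rightarrow> 'b"
  assumes "admissible_ideal I"
    and "uniform_homeomorphism X Y h"
    and "\<forall>n\<in>{1..}. f n \<in> mspace X \<rightarrow> mspace X"
    and "\<forall>n\<in>{1..}. g n \<in> mspace Y \<rightarrow> mspace Y"
    and "uniformly_conjugate X Y h f g"
  shows "ideal_uniformly_convergent I X f \<longleftrightarrow> ideal_uniformly_convergent I Y g"
proof -
  let ?k = "inv_into (mspace X) h"
  have h: "uniformly_continuous_map X Y h" and k: "uniformly_continuous_map Y X ?k"
    and "homeomorphic_map (mtopology_of X) (mtopology_of Y) h"
    using assms(2) by (auto simp: uniform_homeomorphism_def)
  \<comment> \<open>These make \<open>?k\<close> a two-sided inverse on the carriers: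
    \<open>surj\<close> yields \<open>h (?k y) = y\<close>, and \<open>inj\<close> yields
    \<open>?k (h x) = x\<close>.\<close>
  then have inj: "inj_on h (mspace X)" and surj: "h ` mspace X = mspace Y"
    by (auto simp: homeomorphic_eq_everything_map)
  have conj: "g n (h x) = h (f n x)" if "n \<in> {1..}" "x \<in> mspace X" for n x
    using assms(5) that by (auto simp: uniformly_conjugate_def conjugate_def)
  have hX: "h \<in> mspace X \<rightarrow> mspace Y" and kY: "?k \<in> mspace Y \<rightarrow> mspace X"
    using surj by (auto intro: inv_into_into)
  \<comment> \<open>Conjugacy at the point \<open>?k y\<close>.\<close>
  have "g n y = h (f n (?k y))" if "n \<in> {1..}" "y \<in> mspace Y" for n y
    using conj[of n "?k y"] that kY surj by (auto simp: f_inv_into_f)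
  \<comment> \<open>Apply \<open>?k\<close> to the conjugacy equation; it cancels \<open>h\<close>
    because \<open>f n x\<close> lies in \<open>mspace X\<close>.\<close>
  moreover have "f n x = ?k (g n (h x))" if "n \<in> {1..}" "x \<in> mspace X" for n x
    using conj[OF that] that inj assms(3) by (auto simp: Pi_iff)
  ultimately show ?thesis
    using ideal_uniformly_convergent_transfer[OF h kY assms(3)]
      ideal_uniformly_convergent_transfer[OF k hX assms(4)] by blast
qed

end
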